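(* Let $n\ge1$, let $p_1,\dots,p_n$ be distinct primes and $m_1,\dots,m_n\ge 0$ integers. Let $f$ be a multiplicative arithmetic function with $f\in\mathbb{B}\{G_1(N);G_2(N)\}$, where $G_1(N)=N^{a_1}(\log N)^{b_1}$ and $G_2(N)=N^{-a_2}(\log N)^{-b_2}$, and where the exponents satisfy: either $a_1>0$ and $-\infty<b_1<\infty$, or $a_1=0$ and $0\le b_1<\infty$; and either $a_2>0$ and $-\infty<b_2<\infty$, or $a_2=0$ and $0<b_2<\infty$. Suppose there exist real numbers $\mathcal{K}>0$ and $\gamma<a_1$ and an integer $r_*\ge 0$ such that $|L_r(f;p_i^{m_i})|\le \mathcal{K}p_i^{\gamma r}$ for all $r\ge r_*$ and all $i=1,\dots,n$. Then $$R_{\infty}\left(f;\prod_{i=1}^np_i^{m_i}\right)=\prod_{i=1}^nR_{\infty}\left(f;p_i^{m_i}\right)$$ (all limits defining these quantities existing).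
   Context: An arithmetic function $f:\mathbb{Z}_{>0}\to\mathbb{R}$ is multiplicative if $f(1)=1$ and $f(k_1k_2)=f(k_1)f(k_2)$ whenever $\gcd(k_1,k_2)=1$. For a positive integer $q$ put $F\{f;N,q\}=\sum_{k\le N}f(qk)$ (sum over positive integers $k\le N$); in particular $F\{f;N,1\}=\sum_{k\le N}f(k)$. Universality class: for positive functions $G_1,G_2$ (defined for large $N$) with $G_1$ nondecreasing and $G_2(N)\to0$, $f\in\mathbb{B}\{G_1(N);G_2(N)\}$ means that there are constants $0<\mathcal{F},\mathcal{C}<\infty$ such that $\frac{F\{f;N,1\}}{\mathcal{F}G_1(N)}\to1$ as $N\to\infty$ and $\left|\frac{F\{f;N,1\}}{\mathcal{F}G_1(N)}-1\right|<\mathcal{C}\,G_2(N)$ for all sufficiently large $N$. Characteristic functions, for a prime $p$ and integer $m\ge0$: $L_0(f;p^m)=f(p^m)$ and, for $r\ge1$, $L_r(f;p^m)=f(p^{m+r})-\sum_{j=0}^{r-1}L_j(f;p^m)f(p^{r-j})$. Renormalization function: for a positive integer $q$, $R_\infty(f;q)=\lim_{N\to\infty}\frac{F\{f;N,q\}}{F\{f;N,1\}}$. *)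

theory Defs
  imports Complex_Main "HOL-Computational_Algebra.Primes"
begin

text \<open>Arithmetic functions are represented on type \<^typ>\<open>nat\<close>; the value at 0 is never used.\<close>

definition multiplicative :: "(nat \<Rightarrow> real) \<Rightarrow> bool" where
  "multiplicative f \<longleftrightarrow> f 1 = 1 \<and>
     (\<forall>k1>0. \<forall>k2>0. coprime k1 k2 \<longrightarrow> f (k1 * k2) = f k1 * f k2)"

definition summatory :: "(nat \<Rightarrow> real) \<Rightarrow> nat \<Rightarrow> nat \<Rightarrow> real" where
  "summatory f N q = (\<Sum>k=1..N. f (q * k))"

text \<open>Since the scaling functions need only be defined for large arguments, positivity and
  monotonicity are required from some point on.\<close>

definition scaling_pair :: "(nat \<Rightarrow> real) \<Rightarrow> (nat \<Rightarrow> real) \<Rightarrow> bool" where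
  "scaling_pair G1 G2 \<longleftrightarrow>
     (\<forall>\<^sub>F N in sequentially. G1 N > 0) \<and> (\<forall>\<^sub>F N in sequentially. G2 N > 0) \<and>
     (\<exists>N0. mono_on {N0..} G1) \<and> G2 \<longlonglongrightarrow> 0"

definition universality_class :: "(nat \<Rightarrow> real) \<Rightarrow> (nat \<Rightarrow> real) \<Rightarrow> (nat \<Rightarrow> real) set" where
  "universality_class G1 G2 = {f. scaling_pair G1 G2 \<and>
     (\<exists>A>0. \<exists>C>0.
        (\<lambda>N. summatory f N 1 / (A * G1 N)) \<longlonglongrightarrow> 1 \<and>
        (\<forall>\<^sub>F N in sequentially. \<bar>summatory f N 1 / (A * G1 N) - 1\<bar> < C * G2 N))}"

text \<open>The prime and the exponent are separate arguments because \<open>p ^ 0 = 1\<close> does not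
  determine the prime.\<close>

fun char_fun :: "(nat \<Rightarrow> real) \<Rightarrow> nat \<Rightarrow> nat \<Rightarrow> nat \<Rightarrow> real" where
  "char_fun f p m 0 = f (p ^ m)"
| "char_fun f p m (Suc r) =
     f (p ^ (m + Suc r)) - (\<Sum>j=0..r. char_fun f p m j * f (p ^ (Suc r - j)))"

definition renorm_ratio :: "(nat \<Rightarrow> real) \<Rightarrow> nat \<Rightarrow> nat \<Rightarrow> real" where
  "renorm_ratio f q N = summatory f N q / summatory f N 1"

text \<open>Meaningful only if \<open>renorm_ratio f q\<close> converges, which has to be stated separately.\<close>

definition renorm :: "(nat \<Rightarrow> real) \<Rightarrow> nat \<Rightarrow> real" where
  "renorm f q = lim (renorm_ratio f q)"

end

theory Submission
  imports Defs "HOL-Analysis.Uniform_Limit" "HOL-Real_Asymp.Real_Asymp"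
begin

text \<open>The characteristic functions \<open>L\<^sub>r\<close> are the coefficients for which
  \<open>f (q p\<^sup>m k) = \<Sum>\<^sub>r L\<^sub>r f (q k / p\<^sup>r)\<close>, the sum running over \<open>p\<^sup>r\<close> dividing \<open>k\<close>,
  whenever \<open>q\<close> is coprime to \<open>p\<close>. Hence \<open>F(N, q p\<^sup>m) = \<Sum>\<^sub>r L\<^sub>r F(N div p\<^sup>r, q)\<close>.
  Dividing by \<open>F(N, 1)\<close> and letting \<open>N\<close> grow, Tannery's theorem turns convergence of the
  ratio for \<open>q\<close> to \<open>R(q)\<close> into convergence of the ratio for \<open>q p\<^sup>m\<close> to
  \<open>R(q) \<Sum>\<^sub>r L\<^sub>r p powr (-a r)\<close>. The second factor does not depend on \<open>q\<close>, so induction over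
  the primes gives the product formula.\<close>

section \<open>Characteristic functions and dilated summatory functions\<close>

text \<open>The \<open>char_fun f p m r\<close> are the coefficients of the power series with
  coefficients \<open>f (p ^ (m + j))\<close> divided by the one with coefficients
  \<open>f (p ^ j)\<close>; clearing the denominator gives this convolution. \<open>f 1 = 1\<close>
  turns its top term into \<open>char_fun f p m j\<close>.\<close>

lemma char_fun_recurrence:
  assumes "f 1 = 1"
  shows "f (p ^ (m + j)) = (\<Sum>r\<le>j. char_fun f p m r * f (p ^ (j - r)))"
proof (cases j)
  case (Suc i)
  have "(\<Sum>r\<le>Suc i. char_fun f p m r * f (p ^ (Suc i - r)))
      = (\<Sum>r\<le>i. char_fun f p m r * f (p ^ (Suc i - r))) + char_fun f p m (Suc i)"
    using assms by (simp del: char_fun.simps)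
  then show ?thesis
    using Suc by (simp add: atLeast0AtMost)
qed (use assms in simp)

text \<open>Write \<open>k = p ^ j * k'\<close> with \<open>k'\<close> prime to \<open>p\<close>.
  Only \<open>r \<le> j\<close> contribute, and multiplicativity splits \<open>f (q * k')\<close>
  off every term; what remains is the convolution for \<open>f (p ^ (m + j))\<close>.\<close>

lemma multiplicative_char_fun_expansion:
  assumes "multiplicative f" and p: "prime p" and q: "q > 0" "coprime p q" and k: "k > 0"
  shows "f (q * p ^ m * k) =
    (\<Sum>r | p ^ r dvd k. char_fun f p m r * f (q * (k div p ^ r)))"
proof -
  define j where "j = multiplicity p k"
  obtain k' where k': "k = p ^ j * k'" "\<not> p dvd k'"
    using multiplicity_decompose'[of k p] k p unfolding j_def by (auto simp: prime_nat_iff)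
  have pos: "p > 0" "k' > 0"
    using p k k' by (auto simp: prime_gt_0_nat intro!: Nat.gr0I)
  have "coprime p k'"
    using p k'(2) by (simp add: prime_imp_coprime)
  with q have cop: "coprime (p ^ i) (q * k')" for i
    by simp
  have mult: "f (p ^ i * (q * k')) = f (p ^ i) * f (q * k')" for i
    using assms(1) cop[of i] q(1) pos by (simp add: multiplicative_def)
  have "{r. p ^ r dvd k} = {..j}"
    using p k unfolding j_def
    by (auto simp: power_dvd_iff_le_multiplicity prime_nat_iff)
  moreover have "f (q * (k div p ^ r)) = f (p ^ (j - r)) * f (q * k')" if "r \<le> j" for r
  proof -
    have "k = p ^ r * (p ^ (j - r) * k')"
      using that k' by (simp add: power_add[symmetric] mult.assoc[symmetric])
    then have "k div p ^ r = p ^ (j - r) * k'"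
      using pos by simp
    then show ?thesis
      using mult[of "j - r"] by (simp add: mult_ac)
  qed
  ultimately have "(\<Sum>r | p ^ r dvd k. char_fun f p m r * f (q * (k div p ^ r)))
     = (\<Sum>r\<le>j. char_fun f p m r * f (p ^ (j - r))) * f (q * k')"
    by (simp add: sum_distrib_right mult.assoc)
  also have "\<dots> = f (p ^ (m + j)) * f (q * k')"
    using assms(1) by (subst char_fun_recurrence[symmetric]) (auto simp: multiplicative_def)
  also have "\<dots> = f (q * p ^ m * k)"
    using mult[of "m + j"] k'(1) by (simp add: power_add mult_ac)
  finally show ?thesis by simp
qed

lemma sum_multiples:
  fixes g :: "nat \<Rightarrow> 'a::comm_monoid_add"
  assumes "d > 0"
  shows "(\<Sum>k | k \<in> {1..N} \<and> d dvd k. g (k div d)) = (\<Sum>k=1..N div d. g k)"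
proof (rule sum.reindex_bij_witness[of _ "\<lambda>k. d * k" "\<lambda>k. k div d"])
  fix k assume "k \<in> {1..N div d}"
  then show "d * k \<in> {k \<in> {1..N}. d dvd k}"
    using assms by (auto simp: less_eq_div_iff_mult_less_eq mult.commute)
next
  fix k assume "k \<in> {k \<in> {1..N}. d dvd k}"
  then show "k div d \<in> {1..N div d}"
    using assms by (auto simp: div_le_mono dvd_imp_le Suc_le_eq div_greater_zero_iff)
qed (use assms in auto)

text \<open>Sum the pointwise expansion over \<open>k\<close> and interchange the sums. The result
  is finite, but is stated as an infinite series so that the range of \<open>r\<close> does not
  depend on \<open>N\<close>, the form suited to Tannery's theorem.\<close>

lemma summatory_mult_prime_power:
  assumes "multiplicative f" and p: "prime p" and q: "q > 0" "coprime p q"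
  shows "(\<lambda>r. char_fun f p m r * summatory f (N div p ^ r) q) sums summatory f N (q * p ^ m)"
proof -
  let ?L = "char_fun f p m"
  have p1: "p > 1" using p by (rule prime_gt_1_nat)
  have lt: "r < p ^ r" for r
    using power_gt_expt[of p r] p1 by simp
  have "summatory f N (q * p ^ m) = (\<Sum>k=1..N. \<Sum>r | p ^ r dvd k. ?L r * f (q * (k div p ^ r)))"
    unfolding summatory_def
    by (intro sum.cong multiplicative_char_fun_expansion assms refl) auto
  \<comment> \<open>Since \<open>r < p ^ r \<le> k \<le> N\<close>, one range for \<open>r\<close>
    serves all \<open>k\<close>, which makes the sums interchangeable.\<close>
  also have "\<dots> = (\<Sum>k=1..N. \<Sum>r | r \<in> {..N} \<and> p ^ r dvd k. ?L r * f (q * (k div p ^ r)))"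
  proof (intro sum.cong refl)
    fix k assume "k \<in> {1..N}"
    then have "r \<le> N" if "p ^ r dvd k" for r
      using dvd_imp_le[OF that] lt[of r] by auto
    then show "{r. p ^ r dvd k} = {r. r \<in> {..N} \<and> p ^ r dvd k}" by auto
  qed
  also have "\<dots> = (\<Sum>r\<le>N. \<Sum>k | k \<in> {1..N} \<and> p ^ r dvd k. ?L r * f (q * (k div p ^ r)))"
    by (rule sum.swap_restrict) auto
  also have "\<dots> = (\<Sum>r\<le>N. ?L r * summatory f (N div p ^ r) q)"
  proof (intro sum.cong refl)
    fix r
    have "p ^ r > 0" using p1 by simp
    from sum_multiples[OF this, of "\<lambda>k. f (q * k)" N]
    show "(\<Sum>k | k \<in> {1..N} \<and> p ^ r dvd k. ?L r * f (q * (k div p ^ r)))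
      = ?L r * summatory f (N div p ^ r) q"
      by (simp only: sum_distrib_left[symmetric] summatory_def)
  qed
  finally have eq: "summatory f N (q * p ^ m) = (\<Sum>r\<le>N. ?L r * summatory f (N div p ^ r) q)" .
  \<comment> \<open>For \<open>r > N\<close> the quotient \<open>N div p ^ r\<close> is 0 and the
    sum is empty.\<close>
  have "?L r * summatory f (N div p ^ r) q = 0" if "r \<notin> {..N}" for r
    using that lt[of r] by (simp add: summatory_def)
  from sums_finite[OF _ this, of "{..N}"] show ?thesis
    by (simp add: eq)
qed

section \<open>Growth of powers times powers of the logarithm\<close>

text \<open>With \<open>s = ln x\<close>, the logarithm of the function is
  \<open>\<delta> * s + b * ln s\<close>, whose derivative \<open>\<delta> + b / s\<close> is
  nonnegative once \<open>s\<close> is at least |b| / \<delta>.\<close>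

lemma powr_mult_ln_powr_eventually_mono:
  fixes \<delta> b :: real
  assumes "\<delta> > 0"
  obtains x0 where "x0 > 1"
    "\<And>x y. x0 \<le> x \<Longrightarrow> x \<le> y \<Longrightarrow> x powr \<delta> * ln x powr b \<le> y powr \<delta> * ln y powr b"
proof
  define s0 where "s0 = max 1 (\<bar>b\<bar> / \<delta>)"
  show "exp s0 > 1" by (auto simp: s0_def)
  fix x y :: real assume xy: "exp s0 \<le> x" "x \<le> y"
  define s t where "s = ln x" and "t = ln y"
  have pos: "x > 0" "y > 0"
    using xy exp_gt_zero[of s0] by linarith+
  have "s0 \<le> s" "s \<le> t"
    using xy pos by (simp_all add: s_def t_def ln_ge_iff)
  then have st: "s \<le> t" "\<bar>b\<bar> / \<delta> \<le> s" "s > 0" "t > 0"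
    by (auto simp: s0_def)
  \<comment> \<open>In place of the derivative: \<open>ln t - ln s \<le> (t - s) / s\<close>,
    combined with |b| \<le> \<delta> s.\<close>
  have "\<bar>b\<bar> * (ln t - ln s) \<le> (\<delta> * s) * ((t - s) / s)"
    using st assms ln_diff_le[of t s]
    by (intro mult_mono) (auto simp: field_simps)
  then have "- b * (ln t - ln s) \<le> \<delta> * (t - s)"
    using st mult_right_mono[OF abs_ge_minus_self, of "ln t - ln s" b] by simp
  then have "\<delta> * s + b * ln s \<le> \<delta> * t + b * ln t"
    by (simp add: algebra_simps)
  moreover have "x powr \<delta> * ln x powr b = exp (\<delta> * s + b * ln s)"
    "y powr \<delta> * ln y powr b = exp (\<delta> * t + b * ln t)"
    using pos st by (simp_all add: powr_def exp_add s_def t_def)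
  ultimately show "x powr \<delta> * ln x powr b \<le> y powr \<delta> * ln y powr b"
    by simp
qed

text \<open>A Potter-type bound. Dividing out \<open>N powr c\<close> with \<open>c < a\<close> leaves an eventually increasing
  function, so that small \<open>M\<close>, where the asymptotics of \<open>H\<close> say nothing, are covered as well.\<close>

lemma bigo_powr_ln_uniform_bound:
  fixes H :: "nat \<Rightarrow> real" and a b c :: real
  assumes bound: "\<forall>\<^sub>F N in sequentially. \<bar>H N\<bar> \<le> B * (real N powr a * ln (real N) powr b)"
    and "c < a"
  obtains C where "C \<ge> 0"
    "\<forall>\<^sub>F N in sequentially. \<forall>M\<in>{1..N}.
       \<bar>H M\<bar> \<le> C * (real M / real N) powr c * (real N powr a * ln (real N) powr b)"
proof -
  define U where "U = (\<lambda>x::real. x powr (a - c) * ln x powr b)"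
  have U: "x powr a * ln x powr b = x powr c * U x" if "x > 0" for x
    using that by (simp add: U_def powr_diff)
  obtain x0 where x0: "x0 > 1" "\<And>x y. x0 \<le> x \<Longrightarrow> x \<le> y \<Longrightarrow> U x \<le> U y"
    using powr_mult_ln_powr_eventually_mono[of "a - c" b] assms(2) unfolding U_def by auto
  obtain N0 where N0: "\<And>N. N \<ge> N0 \<Longrightarrow> \<bar>H N\<bar> \<le> B * (real N powr a * ln (real N) powr b)"
    using bound unfolding eventually_sequentially by blast
  define N1 where "N1 = max N0 (nat \<lceil>x0\<rceil>)"
  have N1: "N1 \<ge> N0" "real N1 \<ge> x0" "N1 > 0"
    using x0(1) by (auto simp: N1_def, linarith+)
  have U_pos: "U (real N1) > 0"
    using N1 x0(1) by (auto simp: U_def)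
  \<comment> \<open>\<open>D\<close> handles the finitely many \<open>M < N1\<close>: the sum
    majorizes each quotient of |H M| by \<open>real M powr c\<close>, and dividing by
    \<open>U (real N1)\<close> leaves room for the factor \<open>U (real N)\<close>, which is at
    least as large.\<close>
  define D where "D = (\<Sum>k=1..N1. \<bar>H k\<bar> / real k powr c) / U (real N1)"
  have D: "D \<ge> 0"
    using U_pos by (auto simp: D_def intro!: divide_nonneg_pos sum_nonneg)
  show ?thesis
  proof
    show "\<bar>B\<bar> + D \<ge> 0" using D by simp
    have "\<bar>H M\<bar> \<le> (\<bar>B\<bar> + D) * (real M / real N) powr c * (real N powr a * ln (real N) powr b)"
      if N: "N \<ge> N1" and M: "M \<in> {1..N}" for N M
    proof -
      have UN: "U (real N1) \<le> U (real N)"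
        using N N1 by (intro x0(2)) auto
      have "\<bar>H M\<bar> \<le> (\<bar>B\<bar> + D) * (real M powr c * U (real N))"
      proof (cases "M \<ge> N1")
        case True
        have UM: "0 \<le> U (real M)" "U (real M) \<le> U (real N)"
          using True M N1 by (auto simp: U_def intro!: x0(2)[unfolded U_def])
        have "\<bar>H M\<bar> \<le> B * (real M powr c * U (real M))"
          using N0[of M] N1 True U[of "real M"] M by auto
        also have "\<dots> \<le> (\<bar>B\<bar> + D) * (real M powr c * U (real N))"
          using UM D by (intro mult_mono) auto
        finally show ?thesis .
      next
        case False
        have "\<bar>H M\<bar> / real M powr c \<le> (\<Sum>k=1..N1. \<bar>H k\<bar> / real k powr c)"
          using False M by (intro member_le_sum) auto
        also have "\<dots> = D * U (real N1)"
          using U_pos by (simp add: D_def)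
        also have "\<dots> \<le> (\<bar>B\<bar> + D) * U (real N)"
          using D U_pos UN by (intro mult_mono) auto
        finally show ?thesis
          using M by (simp add: field_simps)
      qed
      also have "real M powr c * U (real N) = (real M / real N) powr c * (real N powr a * ln (real N) powr b)"
        using M N N1 U[of "real N"] by (simp add: powr_divide)
      finally show ?thesis by (simp add: mult.assoc)
    qed
    then show "\<forall>\<^sub>F N in sequentially. \<forall>M\<in>{1..N}.
       \<bar>H M\<bar> \<le> (\<bar>B\<bar> + D) * (real M / real N) powr c * (real N powr a * ln (real N) powr b)"
      unfolding eventually_sequentially by blast
  qed
qed

text \<open>Rounding down loses at most a factor 2: \<open>d * (N div d) / N\<close> lies between
  1/2 and 1, so its power \<open>c\<close> is at most 2 to the |c|, whatever the sign of
  \<open>c\<close>.\<close>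

lemma powr_nat_div_ratio_le:
  assumes "0 < d" "d \<le> N"
  shows "(real (N div d) / real N) powr c \<le> 2 powr \<bar>c\<bar> * real d powr (- c)"
proof -
  define M where "M = N div d"
  have "M \<ge> 1" using assms by (simp add: M_def Suc_le_eq div_greater_zero_iff)
  have "N = d * M + N mod d" "N mod d < d"
    using assms by (auto simp: M_def)
  moreover have "d \<le> d * M" using \<open>M \<ge> 1\<close> by simp
  ultimately have "d * M \<le> N" "N \<le> 2 * (d * M)" by linarith+
  then have le: "real d * real M \<le> real N" "real N \<le> 2 * (real d * real M)"
    by (metis of_nat_le_iff of_nat_mult of_nat_numeral)+
  define x where "x = real d * real M / real N"
  have x: "x > 0" "x \<le> 1" "1 / 2 \<le> x"
    using le assms \<open>M \<ge> 1\<close> by (auto simp: x_def field_simps)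
  have "x powr c \<le> x powr (- \<bar>c\<bar>)"
    using x by (intro powr_mono') auto
  also have "\<dots> \<le> (1 / 2) powr (- \<bar>c\<bar>)"
    using x by (intro powr_mono2') auto
  also have "\<dots> = 2 powr \<bar>c\<bar>"
    by (simp add: powr_divide powr_minus field_simps)
  finally have "x powr c * real d powr (- c) \<le> 2 powr \<bar>c\<bar> * real d powr (- c)"
    by (intro mult_right_mono) auto
  moreover have "x powr c * real d powr (- c) = (real M / real N) powr c"
    using assms \<open>M \<ge> 1\<close> by (simp add: x_def powr_mult powr_divide powr_minus field_simps)
  ultimately show ?thesis by (simp add: M_def)
qed

text \<open>Regular variation with index \<open>a\<close>: the ratio of arguments tends to
  \<open>1 / d\<close>, and the ratio of logarithms is 1 plus a convergent quantity over
  \<open>ln N\<close>, so the logarithmic factor disappears.\<close>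

lemma powr_ln_div_quotient_tendsto:
  assumes "d > 0"
  shows "(\<lambda>N. (real (N div d) powr a * ln (real (N div d)) powr b) / (real N powr a * ln (real N) powr b))
    \<longlonglongrightarrow> real d powr (- a)"
proof -
  have ratio: "(\<lambda>N. real (N div d) / real N) \<longlonglongrightarrow> 1 / real d"
  proof (rule real_tendsto_sandwich)
    show "\<forall>\<^sub>F N in sequentially. 1 / real d - 1 / real N \<le> real (N div d) / real N"
      using eventually_gt_at_top[of 0]
    proof eventually_elim
      case (elim N)
      have "N < d * (N div d) + d"
        using dividend_less_times_div[OF assms, of N] by simp
      then have "real N \<le> real d * real (N div d) + real d"
        by (simp flip: of_nat_mult of_nat_add)
      then have "real N / (real d * real N) \<le> (real d * real (N div d) + real d) / (real d * real N)"
        using elim assms by (intro divide_right_mono) auto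
      then show ?case using elim assms by (simp add: add_divide_distrib)
    qed
    show "\<forall>\<^sub>F N in sequentially. real (N div d) / real N \<le> 1 / real d"
      using eventually_gt_at_top[of 0]
    proof eventually_elim
      case (elim N)
      then show ?case using assms of_nat_div_le_of_nat[of N d, where 'a = real] by (simp add: field_simps)
    qed
    show "(\<lambda>N. 1 / real d - 1 / real N) \<longlonglongrightarrow> 1 / real d"
      by real_asymp
  qed simp
  have log_ratio: "(\<lambda>N. 1 + ln (real (N div d) / real N) * (1 / ln (real N))) \<longlonglongrightarrow> 1 + ln (1 / real d) * 0"
  proof (intro tendsto_add tendsto_mult tendsto_const tendsto_ln ratio)
    show "(\<lambda>N. 1 / ln (real N)) \<longlonglongrightarrow> 0" by real_asymp
  qed (use assms in simp)
  have "(\<lambda>N. (real (N div d) / real N) powr a * (1 + ln (real (N div d) / real N) * (1 / ln (real N))) powr b)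
      \<longlonglongrightarrow> (1 / real d) powr a * (1 + ln (1 / real d) * 0) powr b"
    by (intro tendsto_mult tendsto_powr ratio log_ratio tendsto_const) (use assms in auto)
  moreover have "\<forall>\<^sub>F N in sequentially.
      (real (N div d) / real N) powr a * (1 + ln (real (N div d) / real N) * (1 / ln (real N))) powr b
      = (real (N div d) powr a * ln (real (N div d)) powr b) / (real N powr a * ln (real N) powr b)"
    \<comment> \<open>This makes \<open>N div d\<close> positive and \<open>ln (real N)\<close>
      nonzero.\<close>
    using eventually_ge_at_top[of "d + 1"]
  proof eventually_elim
    case (elim N)
    then have pos: "N div d > 0" "N > 1"
      using assms by (auto simp: div_greater_zero_iff)
    then have "1 + ln (real (N div d) / real N) * (1 / ln (real N)) = ln (real (N div d)) / ln (real N)"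
      by (simp add: ln_div field_simps)
    then show ?case
      using pos by (simp add: powr_divide)
  qed
  moreover have "(1 / real d) powr a * (1 + ln (1 / real d) * 0) powr b = real d powr (- a)"
    by (simp add: powr_divide powr_minus field_simps)
  ultimately show ?thesis
    by (simp add: tendsto_cong)
qed

section \<open>Limits of weighted dilated sums\<close>

text \<open>Here \<open>S\<close> stands for F(N, 1), \<open>H\<close> for F(N, q) and
  \<open>L\<close> for the characteristic functions. Regular variation gives the limit of each term,
  the Potter-type bound a geometric majorant, and Tannery's theorem the rest.\<close>

lemma tendsto_dilated_sum:
  fixes S H L :: "nat \<Rightarrow> real" and a b A R \<gamma> K :: real and p r0 :: nat
  defines "G \<equiv> \<lambda>N. real N powr a * ln (real N) powr b"
  assumes "p > 1" and "A > 0" and S: "(\<lambda>N. S N / (A * G N)) \<longlonglongrightarrow> 1"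
    and H: "(\<lambda>N. H N / S N) \<longlonglongrightarrow> R" and "H 0 = 0"
    and "\<gamma> < a" and L: "\<And>r. r \<ge> r0 \<Longrightarrow> \<bar>L r\<bar> \<le> K * real p powr (\<gamma> * real r)"
  shows "(\<lambda>N. \<Sum>r. L r * H (N div p ^ r) / S N) \<longlonglongrightarrow> R * (\<Sum>r. L r * real (p ^ r) powr (- a))"
proof -
  have G_pos: "\<forall>\<^sub>F N in sequentially. G N > 0"
    using eventually_gt_at_top[of 1] by eventually_elim (auto simp: G_def)
  have "\<forall>\<^sub>F N in sequentially. S N / (A * G N) > 1 / 2"
    using order_tendstoD(1)[OF S, of "1 / 2"] by simp
  then have S_ge: "\<forall>\<^sub>F N in sequentially. S N > A / 2 * G N \<and> S N > 0"
    using G_pos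
  proof eventually_elim
    case (elim N)
    have "A * G N > 0" using elim \<open>A > 0\<close> by simp
    then have "A / 2 * G N < S N" using elim by (simp add: field_simps)
    then show ?case using \<open>A * G N > 0\<close> by simp
  qed
  \<comment> \<open>Shows that \<open>H\<close> is O(\<open>G\<close>), the hypothesis of the
    Potter-type bound.\<close>
  have "(\<lambda>N. H N / S N * (S N / (A * G N))) \<longlonglongrightarrow> R * 1"
    by (intro tendsto_mult H S)
  then have "\<forall>\<^sub>F N in sequentially. \<bar>H N / S N * (S N / (A * G N))\<bar> < \<bar>R\<bar> + 1"
    by (intro order_tendstoD(2)[OF tendsto_rabs]) auto
  then have "\<forall>\<^sub>F N in sequentially. \<bar>H N\<bar> \<le> ((\<bar>R\<bar> + 1) * A) * G N"
    using G_pos S_ge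
  proof eventually_elim
    case (elim N)
    then show ?case
      using \<open>A > 0\<close> by (simp add: abs_mult field_simps)
  qed
  then have H_bigo: "\<forall>\<^sub>F N in sequentially. \<bar>H N\<bar> \<le> ((\<bar>R\<bar> + 1) * A) * (real N powr a * ln (real N) powr b)"
    by (simp add: G_def)
  \<comment> \<open>\<open>c < a\<close> is needed for the Potter-type bound,
    \<open>\<gamma> < c\<close> for the ratio \<open>real p powr (\<gamma> - c)\<close> of the
    majorant to be below 1.\<close>
  obtain c where c: "\<gamma> < c" "c < a" using \<open>\<gamma> < a\<close> dense by blast
  obtain C where C: "C \<ge> 0" "\<forall>\<^sub>F N in sequentially. \<forall>M\<in>{1..N}. \<bar>H M\<bar> \<le> C * (real M / real N) powr c * G N"
    using bigo_powr_ln_uniform_bound[OF H_bigo c(2)] unfolding G_def by blast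

  define W where "W = (\<lambda>r. K * real p powr (\<gamma> * real r) * (2 / A * (C * (2 powr \<bar>c\<bar> * real (p ^ r) powr (- c)))))"
  have K: "K \<ge> 0"
    using order_trans[OF abs_ge_zero L[OF order_refl]] \<open>p > 1\<close> by (simp add: zero_le_mult_iff)
  \<comment> \<open>The quantifier over \<open>r\<close> stands inside: the threshold for
    \<open>N\<close> must not depend on \<open>r\<close>.\<close>
  have dilated_bound: "\<forall>\<^sub>F N in sequentially. \<forall>r. \<bar>H (N div p ^ r) / S N\<bar> \<le> 2 / A * (C * (2 powr \<bar>c\<bar> * real (p ^ r) powr (- c)))"
    using C(2) S_ge G_pos
  proof eventually_elim
    case (elim N)
    show ?case
    proof
      fix r
      let ?E = "2 powr \<bar>c\<bar> * real (p ^ r) powr (- c)"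
      show "\<bar>H (N div p ^ r) / S N\<bar> \<le> 2 / A * (C * ?E)"
      proof (cases "p ^ r \<le> N")
        \<comment> \<open>Here \<open>N div p ^ r = 0\<close>, and \<open>H 0 = 0\<close> makes the
          left side vanish.\<close>
        case False
        then show ?thesis using \<open>H 0 = 0\<close> C(1) \<open>A > 0\<close> by simp
      next
        case True
        have "N div p ^ r \<in> {1..N}"
          using True \<open>p > 1\<close> by (simp add: Suc_le_eq div_greater_zero_iff)
        then have "\<bar>H (N div p ^ r)\<bar> \<le> C * (real (N div p ^ r) / real N) powr c * G N"
          using elim by blast
        also have "\<dots> \<le> C * ?E * G N"
          using True \<open>p > 1\<close> C(1) elim
          by (intro mult_right_mono mult_left_mono powr_nat_div_ratio_le) auto
        finally have "\<bar>H (N div p ^ r)\<bar> / S N \<le> C * ?E * G N / (A / 2 * G N)"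
          using elim \<open>A > 0\<close> C(1) by (intro frac_le) auto
        then show ?thesis
          using elim \<open>A > 0\<close> by (simp add: field_simps)
      qed
    qed
  qed
  have bound: "\<forall>\<^sub>F (r, N) in at_top \<times>\<^sub>F sequentially. norm (L r * H (N div p ^ r) / S N) \<le> W r"
    using eventually_prodI[OF eventually_ge_at_top[of r0] dilated_bound]
  proof eventually_elim
    case (elim x)
    obtain r N where x: "x = (r, N)" by force
    have "\<bar>L r\<bar> * \<bar>H (N div p ^ r) / S N\<bar> \<le> W r"
      unfolding W_def using elim L[of r] K by (intro mult_mono) (auto simp: x)
    then show ?case by (simp add: x abs_mult)
  qed
  have "W = (\<lambda>r. K * (2 / A * (C * 2 powr \<bar>c\<bar>)) * (real p powr (\<gamma> - c)) ^ r)"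
  proof
    fix r
    have "real p powr (\<gamma> * real r) * real (p ^ r) powr (- c) = (real p powr (\<gamma> - c)) ^ r"
      using \<open>p > 1\<close> by (simp add: powr_realpow[symmetric] powr_powr powr_add[symmetric] algebra_simps)
    then show "W r = K * (2 / A * (C * 2 powr \<bar>c\<bar>)) * (real p powr (\<gamma> - c)) ^ r"
      by (simp add: W_def mult_ac)
  qed
  moreover have "real p powr (\<gamma> - c) < 1"
    using \<open>p > 1\<close> c(1) by (simp add: powr_less_one)
  ultimately have "summable W"
    by (simp add: summable_mult summable_geometric)

  have limit: "(\<lambda>N. L r * H (N div p ^ r) / S N) \<longlonglongrightarrow> R * (L r * real (p ^ r) powr (- a))" for r
  proof -
    let ?M = "\<lambda>N. N div p ^ r"
    have M: "filterlim ?M at_top sequentially"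
      unfolding filterlim_at_top
    proof
      fix Z
      show "\<forall>\<^sub>F N in sequentially. Z \<le> N div p ^ r"
        using eventually_ge_at_top[of "Z * p ^ r"]
        by eventually_elim (use \<open>p > 1\<close> in \<open>simp add: less_eq_div_iff_mult_less_eq\<close>)
    qed
    \<comment> \<open>The term is split into four factors with limits \<open>R\<close>, 1,
      \<open>real (p ^ r) powr (- a)\<close> and 1.\<close>
    have "(\<lambda>N. L r * (H (?M N) / S (?M N) * (S (?M N) / (A * G (?M N))) * (G (?M N) / G N) / (S N / (A * G N))))
      \<longlonglongrightarrow> L r * (R * 1 * real (p ^ r) powr (- a) / 1)"
      using powr_ln_div_quotient_tendsto[of "p ^ r" a b] \<open>p > 1\<close>
      by (intro tendsto_mult tendsto_divide tendsto_const S filterlim_compose[OF H M]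
          filterlim_compose[OF S M]) (simp_all add: G_def)
    moreover have "\<forall>\<^sub>F N in sequentially.
        L r * (H (?M N) / S (?M N) * (S (?M N) / (A * G (?M N))) * (G (?M N) / G N) / (S N / (A * G N)))
        = L r * H (?M N) / S N"
      using G_pos S_ge eventually_compose_filterlim[OF G_pos M] eventually_compose_filterlim[OF S_ge M]
      by eventually_elim (use \<open>A > 0\<close> in simp)
    ultimately have "(\<lambda>N. L r * H (?M N) / S N) \<longlonglongrightarrow> L r * (R * 1 * real (p ^ r) powr (- a) / 1)"
      by (rule Lim_transform_eventually)
    then show ?thesis
      by (simp add: mult_ac)
  qed
  note tannery = tannerys_theorem[OF limit bound \<open>summable W\<close> sequentially_bot]
  show ?thesis
  \<comment> \<open>For nonzero \<open>R\<close>, summability of the series without the factor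
    \<open>R\<close> follows by dividing; for \<open>R = 0\<close> both limits are 0 whatever value
    the series denotes.\<close>
  proof (cases "R = 0")
    case False
    have "summable (\<lambda>r. R * (L r * real (p ^ r) powr (- a)))"
      using tannery by (blast intro: summable_norm_cancel)
    then have "(\<Sum>r. R * (L r * real (p ^ r) powr (- a))) = R * (\<Sum>r. L r * real (p ^ r) powr (- a))"
      using False by (intro suminf_mult) (rule summable_mult_D)
    then show ?thesis
      using tannery by simp
  qed (use tannery in auto)
qed

section \<open>Factors of prime powers and the product formula\<close>

lemma renorm_ratio_mult_prime_power:
  fixes f :: "nat \<Rightarrow> real" and a b A R \<gamma> K :: real
  assumes f: "multiplicative f" and "A > 0"
    and S: "(\<lambda>N. summatory f N 1 / (A * (real N powr a * ln (real N) powr b))) \<longlonglongrightarrow> 1"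
    and p: "prime p" and q: "q > 0" "coprime p q"
    and "\<gamma> < a" and L: "\<And>r. r \<ge> r0 \<Longrightarrow> \<bar>char_fun f p m r\<bar> \<le> K * real p powr (\<gamma> * real r)"
    and R: "renorm_ratio f q \<longlonglongrightarrow> R"
  shows "renorm_ratio f (q * p ^ m) \<longlonglongrightarrow> R * (\<Sum>r. char_fun f p m r * real (p ^ r) powr (- a))"
proof -
  have "renorm_ratio f (q * p ^ m) N =
      (\<Sum>r. char_fun f p m r * summatory f (N div p ^ r) q / summatory f N 1)" for N
    using sums_divide[OF summatory_mult_prime_power[OF f p q], of m N "summatory f N 1"]
    by (simp add: renorm_ratio_def sums_iff)
  moreover have "(\<lambda>N. \<Sum>r. char_fun f p m r * summatory f (N div p ^ r) q / summatory f N 1)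
      \<longlonglongrightarrow> R * (\<Sum>r. char_fun f p m r * real (p ^ r) powr (- a))"
    using R prime_gt_1_nat[OF p] assms
    by (intro tendsto_dilated_sum[OF _ \<open>A > 0\<close> S _ _ \<open>\<gamma> < a\<close> L])
      (auto simp: summatory_def renorm_ratio_def[abs_def])
  ultimately show ?thesis by presburger
qed

theorem corollary1:
  fixes n :: nat and p m :: "nat \<Rightarrow> nat" and f :: "nat \<Rightarrow> real"
    and a1 b1 a2 b2 K \<gamma> :: real and r0 :: nat
  assumes "n \<ge> 1"
    and "\<And>i. i \<in> {1..n} \<Longrightarrow> prime (p i)"
    and "inj_on p {1..n}"
    and "multiplicative f"
    and "(a1 > 0) \<or> (a1 = 0 \<and> b1 \<ge> 0)"
    and "(a2 > 0) \<or> (a2 = 0 \<and> b2 > 0)"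
    and "f \<in> universality_class
               (\<lambda>N. real N powr a1 * ln (real N) powr b1)
               (\<lambda>N. real N powr (- a2) * ln (real N) powr (- b2))"
    and "K > 0" and "\<gamma> < a1"
    and "\<And>i r. i \<in> {1..n} \<Longrightarrow> r \<ge> r0 \<Longrightarrow>
           \<bar>char_fun f (p i) (m i) r\<bar> \<le> K * real (p i) powr (\<gamma> * real r)"
  shows "convergent (renorm_ratio f (\<Prod>i=1..n. p i ^ m i)) \<and>
    (\<forall>i\<in>{1..n}. convergent (renorm_ratio f (p i ^ m i))) \<and>
    renorm f (\<Prod>i=1..n. p i ^ m i) = (\<Prod>i=1..n. renorm f (p i ^ m i))"
proof -
  obtain A where A: "A > 0"
    and S: "(\<lambda>N. summatory f N 1 / (A * (real N powr a1 * ln (real N) powr b1))) \<longlonglongrightarrow> 1"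
    using assms(7) unfolding universality_class_def by blast
  define \<rho> where "\<rho> i = (\<Sum>r. char_fun f (p i) (m i) r * real (p i ^ r) powr (- a1))" for i
  have step: "renorm_ratio f (q * p i ^ m i) \<longlonglongrightarrow> R * \<rho> i"
    if "i \<in> {1..n}" "q > 0" "coprime (p i) q" "renorm_ratio f q \<longlonglongrightarrow> R" for i q R
    unfolding \<rho>_def
    using renorm_ratio_mult_prime_power[OF assms(4) A S _ _ _ assms(9) assms(10)] assms(2) that
    by blast
  \<comment> \<open>Positivity rules out the value 0 of \<open>0 / 0\<close>, so the ratio for
    \<open>q = 1\<close> is eventually 1; this is the base of the induction.\<close>
  have "\<forall>\<^sub>F N in sequentially. summatory f N 1 / (A * (real N powr a1 * ln (real N) powr b1)) > 0"
    using order_tendstoD(1)[OF S, of 0] by simp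
  then have "\<forall>\<^sub>F N in sequentially. 1 = renorm_ratio f 1 N"
    by eventually_elim (auto simp: renorm_ratio_def)
  then have one: "renorm_ratio f 1 \<longlonglongrightarrow> 1"
    by (rule Lim_transform_eventually[OF tendsto_const])
  \<comment> \<open>Taking \<open>q = 1\<close> identifies \<open>\<rho> i\<close> as the
    renormalization value of the single prime power.\<close>
  have single: "renorm_ratio f (p i ^ m i) \<longlonglongrightarrow> \<rho> i" if "i \<in> {1..n}" for i
    using step[OF that, of 1 1] one by simp
  have "renorm_ratio f (\<Prod>i\<in>I. p i ^ m i) \<longlonglongrightarrow> (\<Prod>i\<in>I. \<rho> i)"
    if "finite I" "I \<subseteq> {1..n}" for I
    using that
  proof (induction I rule: finite_induct)
    case empty
    then show ?case using one by simp
  next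
    case (insert i I)
    \<comment> \<open>Distinctness of the primes makes the new one coprime to the product so far, as
      \<open>step\<close> demands.\<close>
    have "p i \<noteq> p j" if "j \<in> I" for j
      using insert that inj_onD[OF assms(3), of i j] by auto
    then have "coprime (p i) (\<Prod>j\<in>I. p j ^ m j)"
      using insert.prems assms(2) by (intro prod_coprime_right coprime_power_right_iff[THEN iffD2] disjI1 primes_coprime) auto
    moreover have "(\<Prod>j\<in>I. p j ^ m j) > 0"
      using insert.prems assms(2) by (intro prod_pos) (auto simp: prime_gt_0_nat)
    ultimately show ?case
      using step[of i "\<Prod>j\<in>I. p j ^ m j" "\<Prod>j\<in>I. \<rho> j"] insert by (simp add: mult.commute)
  qed
  then have all: "renorm_ratio f (\<Prod>i=1..n. p i ^ m i) \<longlonglongrightarrow> (\<Prod>i=1..n. \<rho> i)"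
    by simp
  show ?thesis
    using convergentI[OF all] convergentI[OF single]
    by (auto simp: renorm_def limI[OF all, simplified] limI[OF single])
qed

end
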